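(* Let $q$ be a prime power, $n$ an odd positive integer with $\gcd(n,q)=1$, and $\gamma\in\mathbb{F}_{q^2}$ with $1+\gamma^{q+1}n=0$. There exists a cyclic code $C$ of length $n$ over $\mathbb{F}_{q^2}$ whose extended code $\widetilde C=\{(c_0,\dots,c_{n-1},-\gamma\sum_{i=0}^{n-1}c_i):(c_0,\dots,c_{n-1})\in C\}$ is Hermitian self-dual if and only if for every prime $r$ dividing $n$, either $\mathrm{ord}_r(q)$ is odd or $\mathrm{ord}_r(q^2)$ is even.
   Context: A cyclic code of length $n$ over $\mathbb{F}_{q^2}$ is an ideal of $\mathbb{F}_{q^2}[x]/(x^n-1)$ (identified with coefficient vectors). The Hermitian dual of a code $D\subseteq\mathbb{F}_{q^2}^{N}$ is $D^{\perp_H}=\{u:\sum_iu_iw_i^q=0\ \forall w\in D\}$, and $D$ is Hermitian self-dual if $D=D^{\perp_H}$. $\mathrm{ord}_r(q)$ is the smallest positive integer $t$ with $q^t\equiv1\pmod r$. *)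

theory Defs
  imports
    "HOL-Library.Cardinality"
    "HOL-Algebra.Algebra"
    "HOL-Algebra.Algebraic_Closure_Type"
    "HOL-Computational_Algebra.Computational_Algebra"
    "HOL-Number_Theory.Number_Theory"
begin

text \<open>
  A code of length \<open>N\<close> over a field \<open>'a\<close> is a set of lists of length \<open>N\<close>; the list
  \<open>[c\<^sub>0, \<dots>, c\<^sub>N\<^sub>-\<^sub>1]\<close> stands for the vector \<open>(c\<^sub>0, \<dots>, c\<^sub>N\<^sub>-\<^sub>1)\<close>.
\<close>

definition cyclic_ideal :: "nat \<Rightarrow> 'a::field poly set" where
  "cyclic_ideal n = PIdl\<^bsub>ring_of_type_algebra\<^esub> (Polynomial.monom 1 n - 1)"

definition cyclic_ring :: "nat \<Rightarrow> 'a::field poly set ring" where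
  "cyclic_ring n = ring_of_type_algebra Quot cyclic_ideal n"

definition residue_class :: "nat \<Rightarrow> 'a::field list \<Rightarrow> 'a poly set" where
  "residue_class n c = cyclic_ideal n +>\<^bsub>ring_of_type_algebra\<^esub> Poly c"

text \<open>
  An ideal of the quotient ring, identified with a set of coefficient vectors: for \<open>n > 0\<close>, each
  residue class has exactly one representative \<open>Poly c\<close> with \<open>length c = n\<close>.
\<close>

definition cyclic_code :: "nat \<Rightarrow> 'a::field list set \<Rightarrow> bool" where
  "cyclic_code n C \<longleftrightarrow>
     (\<exists>I. ideal I (cyclic_ring n) \<and> C = {c. length c = n \<and> residue_class n c \<in> I})"

definition hermitian_dual :: "nat \<Rightarrow> nat \<Rightarrow> 'a::field list set \<Rightarrow> 'a list set" where
  "hermitian_dual q N D =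
     {u. length u = N \<and> (\<forall>w\<in>D. (\<Sum>i<N. u ! i * (w ! i) ^ q) = 0)}"

definition hermitian_self_dual :: "nat \<Rightarrow> nat \<Rightarrow> 'a::field list set \<Rightarrow> bool" where
  "hermitian_self_dual q N D \<longleftrightarrow> D = hermitian_dual q N D"

definition extended_code :: "'a::field \<Rightarrow> 'a list set \<Rightarrow> 'a list set" where
  "extended_code \<gamma> C = (\<lambda>c. c @ [- \<gamma> * sum_list c]) ` C"

end

theory Submission
  imports Defs
begin

text \<open>
  Put \<open>M = x\<^sup>n - 1 = (x - 1) \<Phi>\<close> and let \<open>u\<^sup>*\<close> be \<open>u\<close> with its coefficients raised to the power \<open>q\<close>
  and \<open>x\<close> replaced by \<open>x\<^sup>-\<^sup>1\<close>. The Hermitian product of two words is the constant coefficient of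
  \<open>u w\<^sup>*\<close> modulo \<open>M\<close>, so by cyclicity the extended code of an ideal \<open>I\<close> is self-orthogonal iff
  \<open>\<Phi>\<close> divides \<open>u w\<^sup>*\<close> for all \<open>u, w \<in> I\<close>.

  If a prime \<open>r\<close> dividing \<open>n\<close> divides \<open>q\<^sup>j + 1\<close> with \<open>j\<close> odd, then \<open>w\<^sup>*\<close> is congruent to \<open>w\<close> to the power
  \<open>q\<^sup>j\<close> modulo \<open>x\<^sup>r - 1\<close>. Hence an irreducible factor \<open>p\<close> of \<open>(x\<^sup>r - 1) / (x - 1)\<close> divides all
  \<open>w \<in> I\<close>, while \<open>M / p\<close> is orthogonal to \<open>I\<close> and so lies in \<open>I\<close> if the code is self-dual; this
  contradicts the separability of \<open>M\<close>. If no such \<open>r\<close> exists, no irreducible factor \<open>p\<close> of \<open>\<Phi>\<close>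
  divides \<open>p\<^sup>*\<close>, and a divisor \<open>g\<close> of \<open>\<Phi>\<close> of least degree with \<open>\<Phi>\<close> dividing \<open>g g\<^sup>*\<close> generates a
  self-dual extended code. The orders come in because a prime \<open>r\<close> violates the stated condition
  iff it divides some \<open>q\<^sup>j + 1\<close> with \<open>j\<close> odd.
\<close>

subsection \<open>Polynomials and multiplicative orders\<close>

text \<open>The Euclidean algorithm as an induction on the size of \<open>b\<close>: Bezout
  coefficients for \<open>b\<close> and \<open>a mod b\<close> yield those for \<open>a\<close> and
  \<open>b\<close>.\<close>

lemma coprime_field_poly_bezout:
  fixes a b :: "'a::field poly"
  assumes "coprime a b"
  obtains x y where "x * a + y * b = 1"
proof -
  have "\<exists>x y. x * a + y * b = 1"
    using assms
  proof (induction "euclidean_size b" arbitrary: a b rule: less_induct)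
    case less
    show ?case
    proof (cases "b = 0")
      case True
      then have "a dvd 1" using less.prems by simp
      then obtain x where "1 = a * x" by (elim dvdE)
      then have "x * a + 0 * b = 1" by (simp add: mult.commute)
      then show ?thesis by blast
    next
      case False
      have "coprime b (a mod b)"
        using less.prems by (auto simp: coprime_def dvd_mod_iff)
      then obtain x y where "x * b + y * (a mod b) = 1"
        using less.hyps[of "a mod b" b] mod_size_less[OF False] by blast
      moreover have "a mod b = a - (a div b) * b"
        by (simp add: minus_div_mult_eq_mod)
      ultimately have "y * a + (x - y * (a div b)) * b = 1"
        by (simp add: algebra_simps)
      then show ?thesis by blast
    qed
  qed
  then show ?thesis using that by blast
qed

lemma coprime_dvd_mult_field_poly:
  fixes a b c :: "'a::field poly"
  assumes "coprime a b" "a dvd b * c"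
  shows "a dvd c"
proof -
  obtain x y where "x * a + y * b = 1" using coprime_field_poly_bezout[OF assms(1)] .
  then have "(x * a + y * b) * c = c" by simp
  then have "c = a * (x * c) + y * (b * c)" by (simp add: algebra_simps)
  moreover have "a dvd a * (x * c) + y * (b * c)"
    using dvd_add[OF dvd_triv_left dvd_mult[OF assms(2)]] .
  ultimately show ?thesis by simp
qed

lemma coprime_mult_dvd_field_poly:
  fixes a b c :: "'a::field poly"
  assumes "coprime a b" "a dvd c" "b dvd c"
  shows "a * b dvd c"
proof -
  obtain d where d: "c = b * d" using assms(3) by (elim dvdE)
  then have "a dvd d" using coprime_dvd_mult_field_poly assms(1,2) by blast
  then show ?thesis unfolding d by (simp add: mult.commute mult_dvd_mono)
qed

lemma irreducible_divisor_field_poly: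
  fixes f :: "'a::field poly"
  assumes "f \<noteq> 0" "\<not> is_unit f"
  obtains p where "Factorial_Ring.irreducible p" "p dvd f"
proof -
  \<comment> \<open>A non-unit divisor of least degree is irreducible: splitting it into two
    non-units would leave a factor of smaller degree.\<close>
  define p where "p = arg_min degree (\<lambda>d. d dvd f \<and> \<not> is_unit d)"
  have p: "p dvd f \<and> \<not> is_unit p" unfolding p_def
    by (rule arg_min_natI[of _ f]) (use assms in auto)
  have min: "degree p \<le> degree d" if "d dvd f" "\<not> is_unit d" for d
    unfolding p_def by (rule arg_min_nat_le) (use that in auto)
  have "Factorial_Ring.irreducible p"
  proof (rule Factorial_Ring.irreducibleI)
    show "p \<noteq> 0" using p assms by auto
    fix a b assume ab: "p = a * b"
    then have nz: "a \<noteq> 0" "b \<noteq> 0" using p assms by auto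
    show "is_unit a \<or> is_unit b"
    proof (rule ccontr)
      assume *: "\<not> (is_unit a \<or> is_unit b)"
      then have "degree b > 0" using nz is_unit_iff_degree by blast
      moreover have "degree p \<le> degree a"
        using min[of a] p * ab dvd_trans[of a p f] by simp
      ultimately show False using nz by (simp add: ab degree_mult_eq)
    qed
  qed (use p in auto)
  then show ?thesis using p that by blast
qed

lemma coprime_field_polyI:
  fixes a b :: "'a::field poly"
  assumes "a \<noteq> 0" and "\<And>p. Factorial_Ring.irreducible p \<Longrightarrow> p dvd a \<Longrightarrow> p dvd b \<Longrightarrow> False"
  shows "coprime a b"
proof (rule coprimeI, rule ccontr)
  fix c assume c: "c dvd a" "c dvd b" "\<not> is_unit c"
  then have "c \<noteq> 0" using assms(1) by auto
  then obtain p where "Factorial_Ring.irreducible p" "p dvd c" using c(3) irreducible_divisor_field_poly by blast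
  then show False using assms(2) c dvd_trans by blast
qed

lemma irreducible_coprime_field_poly:
  fixes p f :: "'a::field poly"
  assumes "Factorial_Ring.irreducible p" "\<not> p dvd f"
  shows "coprime p f"
proof (rule coprimeI)
  fix c assume c: "c dvd p" "c dvd f"
  show "is_unit c" using Factorial_Ring.irreducibleD'[OF assms(1) c(1)] assms(2) c(2) dvd_trans by blast
qed

text \<open>The divisibility says q^j = -1 modulo r, and -1 differs from 1 because r is odd. So the
  order of q divides 2j but not j, and the order of q^2 divides the odd number j. Conversely, for
  odd m = \<open>ord r (q\<^sup>2)\<close> the power q^m is a square root of 1 other than 1, hence
  -1 modulo the prime r.\<close>

lemma odd_power_dvd_iff_ord:
  fixes q r :: nat
  assumes "Factorial_Ring.prime r" "odd r"
  shows "(\<exists>j. odd j \<and> r dvd q ^ j + 1) \<longleftrightarrow> even (ord r q) \<and> odd (ord r (q\<^sup>2))"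
proof
  assume "\<exists>j. odd j \<and> r dvd q ^ j + 1"
  then obtain j where j: "odd j" "r dvd q ^ j + 1" by blast
  have r2: "r > 2" using assms prime_ge_2_nat[of r] by (cases "r = 2") auto
  have "int r dvd int (q ^ j + 1) * (int (q ^ j) - 1)"
    using j(2) by (metis dvd_mult2 of_nat_dvd_iff)
  also have "\<dots> = int (q ^ (2 * j)) - int 1"
    by (simp add: algebra_simps power_mult power2_eq_square)
  finally have "[q ^ (2 * j) = 1] (mod r)"
    by (metis cong_iff_dvd_diff cong_int_iff)
  then have 1: "ord r q dvd 2 * j" "ord r (q\<^sup>2) dvd j"
    by (simp_all only: ord_divides[symmetric] power_mult)
  have "\<not> ord r q dvd j"
  proof
    assume "ord r q dvd j"
    then have "[q ^ j = 1] (mod r)" using ord_divides by blast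
    then have "[q ^ j + 1 = 1 + 1] (mod r)" by (rule cong_add) simp
    then have "r dvd 1 + 1" using j(2) cong_dvd_iff by blast
    then show False using r2 by (auto dest: dvd_imp_le)
  qed
  then have "even (ord r q)"
    using 1(1) coprime_dvd_mult_right_iff[of "ord r q" 2 j] by (auto simp: coprime_right_2_iff_odd)
  moreover have "odd (ord r (q\<^sup>2))" using 1(2) j(1) by (meson dvd_trans)
  ultimately show "even (ord r q) \<and> odd (ord r (q\<^sup>2))" by blast
next
  assume *: "even (ord r q) \<and> odd (ord r (q\<^sup>2))"
  define m where "m = ord r (q\<^sup>2)"
  have "m * gcd 2 (ord r q) = ord r q" unfolding m_def by (rule ord_power_aux)
  moreover have "gcd 2 (ord r q) = 2" using * by (simp add: gcd_proj1_iff)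
  ultimately have m: "ord r q = 2 * m" by simp
  have "odd m" using * by (simp add: m_def)
  \<comment> \<open>\<open>ord\<close> takes the value 0 when its arguments are not coprime; oddness
    excludes that case.\<close>
  then have "m > 0" by (rule odd_pos)
  have ncong: "\<not> [q ^ m = 1] (mod r)"
    using ord_minimal[of m r q] \<open>m > 0\<close> m by simp
  have "[(q ^ m)\<^sup>2 = 1] (mod r)"
    using ord[of q r] by (simp add: m power_mult[symmetric] mult.commute)
  then have "[(int (q ^ m))\<^sup>2 = 1] (mod int r)"
    by (metis cong_int_iff of_nat_1 of_nat_power)
  then have "int r dvd (int (q ^ m))\<^sup>2 - 1" by (simp add: cong_iff_dvd_diff)
  then have "int r dvd (int (q ^ m) - 1) * (int (q ^ m) + 1)"
    by (simp add: algebra_simps power2_eq_square)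
  then have "int r dvd int (q ^ m) - 1 \<or> int r dvd int (q ^ m) + 1"
    using assms(1) by (simp add: prime_dvd_mult_iff)
  moreover have "\<not> int r dvd int (q ^ m) - 1"
    using ncong by (metis cong_iff_dvd_diff cong_int_iff of_nat_1)
  ultimately have "int r dvd int (q ^ m + 1)" by (simp add: add.commute)
  then have "r dvd q ^ m + 1" by (simp only: of_nat_dvd_iff)
  with \<open>odd m\<close> show "\<exists>j. odd j \<and> r dvd q ^ j + 1" by blast
qed

section \<open>Finite fields and the polynomials x^n - 1\<close>

lemma CHAR_of_primepow_card:
  fixes q :: nat
  assumes "primepow q" "CARD('a::{field,finite}) = q ^ 2"
  obtains k where "Factorial_Ring.prime CHAR('a)" "k > 0" "q = CHAR('a) ^ k"
proof -
  obtain p k where p: "Factorial_Ring.prime p" "k > 0" "q = p ^ k" using assms(1) unfolding primepow_def by blast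
  have "CHAR('a) > 0" by (rule finite_imp_CHAR_pos) simp
  then have c: "Factorial_Ring.prime CHAR('a)" by (rule prime_CHAR_semidom)
  moreover have "CHAR('a) dvd p ^ (k * 2)"
    using CHAR_dvd_CARD[where 'a = 'a] assms(2) p(3) by (simp add: power_mult)
  ultimately have "CHAR('a) dvd p" by (rule prime_dvd_power)
  then have "CHAR('a) = p" using c p(1) by (simp add: primes_dvd_imp_eq)
  with that c p show ?thesis by blast
qed

text \<open>Multiplication by a nonzero x permutes the nonzero elements, so their product is
  unchanged when every factor is multiplied by x.\<close>

lemma power_card_eq_self:
  fixes x :: "'a :: {field, finite}"
  shows "x ^ CARD('a) = x"
proof (cases "x = 0")
  case False
  let ?U = "UNIV - {0} :: 'a set"
  have "bij_betw ((*) x) ?U ?U"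
    by (rule bij_betw_byWitness[where f' = "\<lambda>y. y / x"]) (use False in auto)
  then have "\<Prod>?U = (\<Prod>y\<in>?U. x * y)"
    using prod.reindex_bij_betw[of "(*) x" ?U ?U "\<lambda>y. y"] by (simp only:)
  also have "\<dots> = x ^ card ?U * \<Prod>?U" by (simp only: prod.distrib prod_constant)
  finally have "1 * \<Prod>?U = x ^ card ?U * \<Prod>?U" by (simp only: mult_1)
  then have "x ^ card ?U = 1" by (subst (asm) mult_right_cancel) simp_all
  moreover have "CARD('a) = Suc (card ?U)" by (rule card.remove) simp_all
  ultimately show ?thesis by (simp only: power_Suc mult_1_right)
qed (simp add: power_0_left)

text \<open>Applied to the q-th power map, to its square and to the embedding \<open>to_ac\<close>
  into the algebraic closure.\<close>

lemma map_poly_hom_mult: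
  fixes f :: "'a::comm_semiring_1 \<Rightarrow> 'b::comm_semiring_1"
  assumes "f 0 = 0" "\<And>x y. f (x + y) = f x + f y" "\<And>x y. f (x * y) = f x * f y"
  shows "map_poly f (p * r) = map_poly f p * map_poly f r"
proof (rule poly_eqI)
  fix i
  have "f (sum h A) = (\<Sum>x\<in>A. f (h x))" if "finite A" for h :: "nat \<Rightarrow> 'a" and A
    using that by (induction A) (auto simp: assms)
  then show "coeff (map_poly f (p * r)) i = coeff (map_poly f p * map_poly f r) i"
    by (simp add: coeff_map_poly assms coeff_mult)
qed

lemma map_poly_hom_add:
  fixes f :: "'a::comm_semiring_1 \<Rightarrow> 'b::comm_semiring_1"
  assumes "f 0 = 0" "\<And>x y. f (x + y) = f x + f y"
  shows "map_poly f (p + r) = map_poly f p + map_poly f r"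
  by (rule poly_eqI) (simp add: coeff_map_poly assms)

text \<open>Where x^r = 1, exponents count only modulo r. For j \<le> i the difference is x^j
  ((x^r)^k - 1); the other case follows by a change of sign.\<close>

lemma monom_dvd_monom_diff:
  assumes "[i = j] (mod r)"
  shows "Polynomial.monom 1 r - 1 dvd Polynomial.monom 1 i - (Polynomial.monom 1 j :: 'a::comm_ring_1 poly)"
proof -
  have *: "Polynomial.monom 1 r - 1 dvd Polynomial.monom 1 i - (Polynomial.monom 1 j :: 'a poly)"
    if ij: "[i = j] (mod r)" "j \<le> i" for i j
  proof -
    have "r dvd i - j" using ij by (simp add: cong_altdef_nat)
    then obtain k where k: "i = j + r * k" using ij(2) by (metis dvd_def le_add_diff_inverse)
    have "(Polynomial.monom 1 i :: 'a poly) - Polynomial.monom 1 j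
        = Polynomial.monom 1 j * (Polynomial.monom 1 r ^ k - 1)"
      by (simp add: k monom_power mult_monom algebra_simps)
    moreover have "Polynomial.monom 1 r - 1 dvd Polynomial.monom 1 r ^ k - (1 :: 'a poly)"
      unfolding power_diff_1_eq[of "Polynomial.monom 1 r" k] by (rule dvd_triv_left)
    ultimately show ?thesis by simp
  qed
  show ?thesis
  proof (cases "j \<le> i")
    case False
    then have "Polynomial.monom 1 r - 1 dvd Polynomial.monom 1 j - (Polynomial.monom 1 i :: 'a poly)"
      using *[of j i] assms by (simp add: cong_sym)
    then show ?thesis
      by (subst minus_diff_eq[symmetric]) (simp only: dvd_minus_iff)
  next
    case True
    then show ?thesis using *[OF assms] by simp
  qed
qed

lemma degree_monom_minus_one:
  assumes "n > 0"
  shows "degree (Polynomial.monom 1 n - 1 :: 'a::comm_ring_1 poly) = n"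
proof (rule antisym)
  let ?M = "Polynomial.monom 1 n - 1 :: 'a poly"
  show "degree ?M \<le> n" by (rule degree_diff_le) (simp_all add: degree_monom_le)
  have "Polynomial.coeff ?M n = 1" using assms by (simp add: coeff_1)
  then show "n \<le> degree ?M" by (intro le_degree) simp
qed

lemma monom_minus_one_eq:
  "Polynomial.monom 1 n - 1 = [:-1, 1:] * (\<Sum>i<n. Polynomial.monom (1::'a::comm_ring_1) i)"
proof -
  have pow: "Polynomial.monom 1 1 ^ i = (Polynomial.monom 1 i :: 'a poly)" for i
    by (simp add: monom_power)
  have "Polynomial.monom 1 n - 1 = (Polynomial.monom 1 1 - 1) * (\<Sum>i<n. Polynomial.monom (1::'a) i)"
    using power_diff_1_eq[of "Polynomial.monom 1 1 :: 'a poly" n] unfolding pow .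
  also have "Polynomial.monom 1 1 - 1 = ([:-1, 1:] :: 'a poly)" by (simp add: monom_altdef one_pCons)
  finally show ?thesis .
qed

lemma poly_Poly_1: "poly (Poly c) 1 = sum_list (c :: 'a::comm_semiring_1 list)"
  by (induction c) auto

subsection \<open>Cyclic codes as ideals of the polynomial ring\<close>

lemma (in comm_ring_1) ring_of_type_algebra_simps [simp]:
  "carrier (ring_of_type_algebra :: 'a ring) = UNIV"
  "x \<otimes>\<^bsub>ring_of_type_algebra\<^esub> y = x * y"
  "x \<oplus>\<^bsub>ring_of_type_algebra\<^esub> y = x + y"
  "\<one>\<^bsub>ring_of_type_algebra\<^esub> = 1"
  "\<zero>\<^bsub>ring_of_type_algebra\<^esub> = 0"
  by (simp_all add: ring_of_type_algebra_def)

text \<open>Closure under negation comes from multiplication by -1. The criterion lets later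
  arguments use ordinary polynomial arithmetic.\<close>

lemma ring_ideal_of_type_algebra_iff:
  fixes I :: "'a::comm_ring_1 set"
  shows "ideal I ring_of_type_algebra \<longleftrightarrow>
    0 \<in> I \<and> (\<forall>x\<in>I. \<forall>y\<in>I. x + y \<in> I) \<and> (\<forall>x\<in>I. \<forall>a. a * x \<in> I)"
proof
  assume "ideal I ring_of_type_algebra"
  then interpret I: ideal I "ring_of_type_algebra" .
  show "0 \<in> I \<and> (\<forall>x\<in>I. \<forall>y\<in>I. x + y \<in> I) \<and> (\<forall>x\<in>I. \<forall>a. a * x \<in> I)"
    using additive_subgroup.zero_closed[OF I.additive_subgroup_axioms]
      additive_subgroup.a_closed[OF I.additive_subgroup_axioms] I.I_l_closed by simp
next
  assume *: "0 \<in> I \<and> (\<forall>x\<in>I. \<forall>y\<in>I. x + y \<in> I) \<and> (\<forall>x\<in>I. \<forall>a. a * x \<in> I)"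
  interpret cring "ring_of_type_algebra :: 'a ring" by (rule cring_from_type_algebra)
  have neg: "- x \<in> I" if "x \<in> I" for x using * that by (metis mult_minus1)
  have inv: "inv\<^bsub>add_monoid ring_of_type_algebra\<^esub> x = - x" for x :: 'a
    using minus_equality[of "- x" x] by (simp add: a_inv_def)
  show "ideal I ring_of_type_algebra"
  proof (rule idealI)
    show "ring (ring_of_type_algebra :: 'a ring)" by (rule ring_from_type_algebra)
    show "subgroup I (add_monoid ring_of_type_algebra)"
    proof (rule subgroup.intro)
      fix x assume "x \<in> I"
      then show "inv\<^bsub>add_monoid ring_of_type_algebra\<^esub> x \<in> I" using neg by (simp only: inv)
    qed (use * in auto)
  qed (use * in \<open>auto simp: mult.commute\<close>)
qed

lemma cyclic_ideal_eq: "cyclic_ideal n = {f. Polynomial.monom 1 n - 1 dvd f}"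
  by (auto simp: cyclic_ideal_def cgenideal_def dvd_def mult.commute)

lemma ideal_cyclic_ideal: "ideal (cyclic_ideal n) ring_of_type_algebra"
  by (auto simp: ring_ideal_of_type_algebra_iff cyclic_ideal_eq)

text \<open>The correspondence between ideals of a quotient and ideals containing the kernel: take
  preimages in one direction and images in the other.\<close>

lemma cyclic_code_iff:
  "cyclic_code n C \<longleftrightarrow> (\<exists>I. ideal I ring_of_type_algebra \<and> Polynomial.monom 1 n - 1 \<in> I \<and>
     C = {c :: 'a::field list. length c = n \<and> Poly c \<in> I})"
proof
  interpret J: ideal "cyclic_ideal n" "ring_of_type_algebra :: 'a poly ring" by (rule ideal_cyclic_ideal)
  interpret h: ring_hom_ring "ring_of_type_algebra :: 'a poly ring" "cyclic_ring n"
    "(+>\<^bsub>ring_of_type_algebra\<^esub>) (cyclic_ideal n)"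
    unfolding cyclic_ring_def by (rule J.rcos_ring_hom_ring)
  let ?M = "Polynomial.monom 1 n - 1 :: 'a poly"
  {
    assume "cyclic_code n C"
    then obtain I where I: "ideal I (cyclic_ring n)" "C = {c. length c = n \<and> residue_class n c \<in> I}"
      unfolding cyclic_code_def by blast
    let ?I = "{f. cyclic_ideal n +>\<^bsub>ring_of_type_algebra\<^esub> f \<in> I}"
    have "ideal ?I ring_of_type_algebra"
      using h.ideal_vimage[OF I(1)] by simp
    moreover have "?M \<in> ?I"
    proof -
      have "cyclic_ideal n +>\<^bsub>ring_of_type_algebra\<^esub> ?M = \<zero>\<^bsub>cyclic_ring n\<^esub>"
        using J.a_rcos_const[of ?M] by (simp add: cyclic_ring_def FactRing_def cyclic_ideal_eq)
      moreover have "\<zero>\<^bsub>cyclic_ring n\<^esub> \<in> I"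
        using I(1) by (simp add: additive_subgroup.zero_closed ideal.axioms(1))
      ultimately show ?thesis by simp
    qed
    moreover have "C = {c. length c = n \<and> Poly c \<in> ?I}"
      using I(2) by (simp add: residue_class_def)
    ultimately show "\<exists>I. ideal I ring_of_type_algebra \<and> ?M \<in> I \<and> C = {c. length c = n \<and> Poly c \<in> I}"
      by blast
  }
  {
    assume "\<exists>I. ideal I ring_of_type_algebra \<and> ?M \<in> I \<and> C = {c. length c = n \<and> Poly c \<in> I}"
    then obtain I where I: "ideal I ring_of_type_algebra" "?M \<in> I" "C = {c. length c = n \<and> Poly c \<in> I}"
      by blast
    let ?I = "(+>\<^bsub>ring_of_type_algebra\<^esub>) (cyclic_ideal n) ` I"
    interpret I: ideal I "ring_of_type_algebra :: 'a poly ring" by (rule I(1))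
    have "ideal ?I (cyclic_ring n)" unfolding cyclic_ring_def
      by (rule J.ring_ideal_imp_quot_ideal[OF ideal_cyclic_ideal I(1)])
    \<comment> \<open>The image determines I because I contains all multiples of x^n - 1:
      polynomials in the same coset lie in I together.\<close>
    moreover have "cyclic_ideal n +>\<^bsub>ring_of_type_algebra\<^esub> f \<in> ?I \<longleftrightarrow> f \<in> I" for f
    proof
      assume "cyclic_ideal n +>\<^bsub>ring_of_type_algebra\<^esub> f \<in> ?I"
      then obtain g where g: "g \<in> I"
        "cyclic_ideal n +>\<^bsub>ring_of_type_algebra\<^esub> f = cyclic_ideal n +>\<^bsub>ring_of_type_algebra\<^esub> g" by blast
      have "f \<in> cyclic_ideal n +>\<^bsub>ring_of_type_algebra\<^esub> f"
        using J.a_rcos_self by simp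
      then obtain m where m: "?M dvd m" "f = m + g"
        unfolding g(2) by (auto simp: a_r_coset_def' cyclic_ideal_eq)
      have "m \<in> I" using m(1) I(1,2) by (auto simp: dvd_def ring_ideal_of_type_algebra_iff mult.commute)
      then show "f \<in> I" using m g(1) I(1) by (simp add: ring_ideal_of_type_algebra_iff)
    qed auto
    ultimately show "cyclic_code n C"
      unfolding cyclic_code_def I(3) residue_class_def by blast
  }
qed

section \<open>The setting, the conjugation \<open>star\<close> and the functional
  \<open>tau\<close>\<close>

locale hermitian_setting =
  fixes q n :: nat and \<gamma> :: "'a::{field,finite}"
  assumes primepow_q: "primepow q"
    and card_field: "CARD('a) = q ^ 2"
    and n_pos: "n > 0"
    and coprime_n_q: "coprime n q"
    and gamma: "1 + \<gamma> ^ (q + 1) * of_nat n = 0"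
begin

definition M :: "'a poly" where "M = Polynomial.monom 1 n - 1"

definition Phi :: "'a poly" where "Phi = (\<Sum>i<n. Polynomial.monom 1 i)"

text \<open>Modulo \<open>M\<close> the power \<open>x\<^sup>n\<^sup>-\<^sup>1\<close> is the inverse of \<open>x\<close>.\<close>

definition star :: "'a poly \<Rightarrow> 'a poly" where
  "star u = pcompose (map_poly (\<lambda>a. a ^ q) u) (Polynomial.monom 1 (n - 1))"

definition tau :: "'a poly \<Rightarrow> 'a" where "tau f = Polynomial.coeff (f mod M) 0"

lemma q_pos: "q > 0"
  using primepow_q by (simp add: primepow_gt_0_nat)

lemma of_nat_n_nonzero: "(of_nat n :: 'a) \<noteq> 0"
  using gamma by auto

text \<open>Stated for every semiring with the characteristic of the field, since it serves the
  field, its polynomials and its algebraic closure.\<close>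

lemma frobenius_add:
  fixes x y :: "'b::comm_semiring_1"
  assumes "CHAR('b) = CHAR('a)"
  shows "(x + y) ^ (q ^ j) = x ^ (q ^ j) + y ^ (q ^ j)"
proof -
  obtain k where k: "Factorial_Ring.prime CHAR('a)" "k > 0" "q = CHAR('a) ^ k"
    by (rule CHAR_of_primepow_card[OF primepow_q card_field])
  show ?thesis
  proof (rule freshmans_dream')
    show "Factorial_Ring.prime CHAR('b)" using k(1) assms by simp
    show "q ^ j = CHAR('b) ^ (k * j)" unfolding assms k(3) power_mult ..
  qed
qed

lemma frobenius_add_1:
  fixes x y :: "'b::comm_semiring_1"
  assumes "CHAR('b) = CHAR('a)"
  shows "(x + y) ^ q = x ^ q + y ^ q"
  using frobenius_add[OF assms, of x y 1] by simp

lemma power_q_q: "(x ^ q) ^ q = (x :: 'a)"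
  using power_card_eq_self[of x] by (simp add: card_field power2_eq_square power_mult)

lemma power_q_odd:
  fixes x :: 'a
  assumes "odd j"
  shows "x ^ (q ^ j) = x ^ q"
proof -
  have "x ^ (q ^ (2 * i + 1)) = x ^ q" for i
  proof (induction i)
    case (Suc i)
    have "x ^ (q ^ (2 * Suc i + 1)) = ((x ^ (q ^ (2 * i + 1))) ^ q) ^ q"
      by (simp add: power_mult[symmetric] mult_ac)
    then show ?case using Suc power_q_q by simp
  qed simp
  then show ?thesis using assms by (auto elim: oddE)
qed

lemma degree_M: "degree M = n"
  unfolding M_def using n_pos by (rule degree_monom_minus_one)

lemma M_nonzero: "M \<noteq> 0"
  using degree_M n_pos by auto

lemma M_eq: "M = [:-1, 1:] * Phi"
  unfolding M_def Phi_def by (rule monom_minus_one_eq)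

lemma poly_Phi_1: "poly Phi 1 = of_nat n"
  by (simp add: Phi_def poly_sum poly_monom)

lemma Phi_dvd_M: "Phi dvd M"
  unfolding M_eq by (rule dvd_triv_right)

subsection \<open>The conjugation\<close>

lemma star_pCons: "star (pCons a u) = [:a ^ q:] + Polynomial.monom 1 (n - 1) * star u"
  using q_pos by (simp add: star_def map_poly_pCons pcompose_pCons)

lemma star_0 [simp]: "star 0 = 0"
  by (simp add: star_def)

lemma star_const: "star [:a:] = [:a ^ q:]"
  by (simp add: star_pCons)

lemma star_1 [simp]: "star 1 = 1"
  using star_const[of 1] by (simp add: one_pCons)

lemma star_add: "star (u + v) = star u + star v"
  using q_pos unfolding star_def
  by (subst map_poly_hom_add) (auto simp: frobenius_add_1 pcompose_add)

lemma star_mult: "star (u * v) = star u * star v"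
  using q_pos unfolding star_def
  by (subst map_poly_hom_mult) (auto simp: frobenius_add_1 pcompose_mult power_mult_distrib)

lemma star_diff: "star (u - v) = star u - star v"
  using star_add[of "u - v" v] by simp

lemma star_sum: "star (sum f A) = (\<Sum>x\<in>A. star (f x))"
  by (induction A rule: infinite_finite_induct) (auto simp: star_add)

lemma star_monom: "star (Polynomial.monom a k) = Polynomial.monom (a ^ q) ((n - 1) * k)"
proof (induction k)
  case 0
  then show ?case by (simp add: monom_0 star_const)
next
  case (Suc k)
  then show ?case using q_pos by (simp add: monom_Suc star_pCons mult_monom)
qed

lemma dvd_star: "u dvd v \<Longrightarrow> star u dvd star v"
  by (auto simp: dvd_def star_mult)

text \<open>\<open>star M\<close> is x^((n-1)n) - 1, whose exponent is a multiple of n. Hence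
  \<open>star\<close> is well defined modulo \<open>M\<close>.\<close>

lemma M_dvd_star_M: "M dvd star M"
  using monom_dvd_monom_diff[of "(n - 1) * n" 0 n]
  by (simp add: M_def star_diff star_monom cong_0_iff)

lemma M_dvd_star: "M dvd u \<Longrightarrow> M dvd star u"
  using M_dvd_star_M dvd_star dvd_trans by blast

text \<open>Conjugating twice raises coefficients to the power q^2, which fixes them, and turns x
  into x^((n-1)^2). As (n-1)^2 is 1 modulo n, this is the identity modulo \<open>M\<close>.\<close>

lemma M_dvd_star_star: "M dvd star (star u) - u"
proof (induction u rule: pCons_induct)
  case (pCons a u)
  let ?x = "Polynomial.monom 1 ((n - 1) * (n - 1)) :: 'a poly"
  have "[(n - 1) * (n - 1) = 1] (mod n)"
  proof (cases "n = 1")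
    case False
    then have "n = (n - 2) + 2" using n_pos by simp
    then obtain k where "n = k + 2" by blast
    then have "(n - 1) * (n - 1) = 1 + k * n" by (simp add: algebra_simps)
    then show ?thesis by (simp only: cong_def mod_mult_self1)
  qed simp
  then have "M dvd ?x - Polynomial.monom 1 1" unfolding M_def by (rule monom_dvd_monom_diff)
  then have "M dvd ?x * (star (star u) - u) + (?x - Polynomial.monom 1 1) * u"
    using pCons by simp
  also have "\<dots> = star (star (pCons a u)) - pCons a u"
    by (simp add: star_pCons star_add star_mult star_monom star_const power_q_q algebra_simps
        pCons_one monom_Suc monom_0)
  finally show ?case .
qed simp

text \<open>Modulo r both n - 1 and q^j are -1, so x^(n-1) and x^(q^j) agree modulo x^r - 1. On
  coefficients the powers q and q^j agree because j is odd, and the power q^j is additive.\<close>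

lemma star_cong_power:
  assumes "odd j" "r dvd q ^ j + 1" "r dvd n"
  shows "Polynomial.monom 1 r - 1 dvd star u - u ^ (q ^ j)"
proof (induction u rule: pCons_induct)
  case 0
  then show ?case using q_pos by (simp add: power_0_left)
next
  case (pCons a u)
  let ?R = "Polynomial.monom 1 r - 1 :: 'a poly"
  have "[(n - 1) + 1 = q ^ j + 1] (mod r)"
    using assms(2,3) n_pos by (simp add: cong_def mod_eq_0_iff_dvd)
  then have "[n - 1 = q ^ j] (mod r)" by (rule cong_add_rcancel_nat[THEN iffD1])
  then have "?R dvd Polynomial.monom 1 (n - 1) - Polynomial.monom 1 (q ^ j)"
    by (rule monom_dvd_monom_diff)
  then have "?R dvd (Polynomial.monom 1 (n - 1) - Polynomial.monom 1 (q ^ j)) * star u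
      + Polynomial.monom 1 (q ^ j) * (star u - u ^ (q ^ j))"
    using pCons by simp
  also have "\<dots> = Polynomial.monom 1 (n - 1) * star u - Polynomial.monom 1 (q ^ j) * u ^ (q ^ j)"
    by (simp add: algebra_simps)
  also have "\<dots> = star (pCons a u) - pCons a u ^ (q ^ j)"
  proof -
    have "pCons a u = [:a:] + Polynomial.monom 1 1 * u" by (simp add: monom_Suc monom_0)
    then have "pCons a u ^ (q ^ j) = [:a:] ^ (q ^ j) + (Polynomial.monom 1 1 * u) ^ (q ^ j)"
      by (simp only: frobenius_add semiring_char_poly)
    also have "[:a:] ^ (q ^ j) = [:a ^ q:]"
      using power_q_odd[OF assms(1)] by (simp add: poly_const_pow)
    finally show ?thesis by (simp add: star_pCons power_mult_distrib monom_power)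
  qed
  finally show ?case .
qed

subsection \<open>The trace form\<close>

lemma tau_add: "tau (f + g) = tau f + tau g"
  by (simp add: tau_def poly_mod_add_left)

lemma tau_0 [simp]: "tau 0 = 0"
  by (simp add: tau_def)

lemma tau_smult: "tau (smult c f) = c * tau f"
  by (simp add: tau_def mod_smult_left)

lemma tau_sum: "tau (sum f A) = (\<Sum>x\<in>A. tau (f x))"
  by (induction A rule: infinite_finite_induct) (auto simp: tau_add)

lemma tau_cong: "M dvd f - g \<Longrightarrow> tau f = tau g"
  by (simp add: tau_def mod_eq_dvd_iff[symmetric])

lemma tau_monom: "tau (Polynomial.monom c k) = (if n dvd k then c else 0)"
proof -
  have "M dvd Polynomial.monom 1 k - Polynomial.monom 1 (k mod n)" unfolding M_def
    by (rule monom_dvd_monom_diff) simp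
  then have "tau (Polynomial.monom 1 k) = tau (Polynomial.monom 1 (k mod n))" by (rule tau_cong)
  also have "\<dots> = (if n dvd k then 1 else 0)"
    using n_pos by (auto simp: tau_def mod_poly_less degree_M degree_monom_eq)
  finally show ?thesis
    using tau_smult[of c "Polynomial.monom 1 k"] by (simp add: smult_monom)
qed

text \<open>Orthonormality of the monomials: x^((n-1)j) plays the role of x^(-j), so the exponent
  stands for i - j modulo n. Adding j shows this within the natural numbers.\<close>

lemma dvd_index_iff: "i < n \<Longrightarrow> j < n \<Longrightarrow> n dvd (n - 1) * j + i \<longleftrightarrow> i = j"
proof -
  assume ij: "i < n" "j < n"
  have "n dvd (n - 1) * j + i \<longleftrightarrow> [((n - 1) * j + i) + j = 0 + j] (mod n)"
    by (simp only: cong_add_rcancel_nat cong_0_iff)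
  also have "((n - 1) * j + i) + j = n * j + i"
    using n_pos by (cases n) auto
  also have "[n * j + i = 0 + j] (mod n) \<longleftrightarrow> i = j"
    using ij by (simp add: cong_def)
  finally show ?thesis .
qed

lemma tau_monom_mult:
  assumes "degree f < n" "k < n"
  shows "tau (Polynomial.monom 1 ((n - 1) * k) * f) = Polynomial.coeff f k"
proof -
  have "f = (\<Sum>i<n. Polynomial.monom (Polynomial.coeff f i) i)"
    using poly_as_sum_of_monoms'[of f "n - 1"] assms n_pos
    by (simp add: lessThan_Suc_atMost[symmetric])
  then have "tau (Polynomial.monom 1 ((n - 1) * k) * f) =
    tau (\<Sum>i<n. Polynomial.monom 1 ((n - 1) * k) * Polynomial.monom (Polynomial.coeff f i) i)"
    by (metis sum_distrib_left)
  also have "\<dots> = (\<Sum>i<n. if i = k then Polynomial.coeff f i else 0)"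
    unfolding tau_sum by (rule sum.cong) (use assms in \<open>auto simp: mult_monom tau_monom dvd_index_iff simp del: One_nat_def\<close>)
  finally show ?thesis using assms by simp
qed

text \<open>Nondegeneracy: multiplying by x^((n-1)k), the inverse of x^k modulo \<open>M\<close>,
  moves the k-th coefficient of the residue to the constant term.\<close>

lemma M_dvdI:
  assumes "\<And>k. tau (Polynomial.monom 1 ((n - 1) * k) * f) = 0"
  shows "M dvd f"
proof -
  have deg: "degree (f mod M) < n"
    using degree_mod_less[OF M_nonzero, of f] degree_M n_pos by auto
  have "f mod M = 0"
  proof (rule poly_eqI)
    fix k
    show "Polynomial.coeff (f mod M) k = Polynomial.coeff 0 k"
    proof (cases "k < n")
      case True
      have "M dvd Polynomial.monom 1 ((n - 1) * k) * (f mod M - f)"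
        by (intro dvd_mult) (metis mod_eq_dvd_iff mod_mod_trivial)
      then have "tau (Polynomial.monom 1 ((n - 1) * k) * (f mod M)) = tau (Polynomial.monom 1 ((n - 1) * k) * f)"
        by (intro tau_cong) (simp add: right_diff_distrib)
      then show ?thesis using tau_monom_mult[OF deg True] assms by simp
    qed (use deg in \<open>simp add: coeff_eq_0\<close>)
  qed
  then show ?thesis by (simp add: mod_eq_0_iff_dvd)
qed

lemma Poly_eq_sum: "Poly c = (\<Sum>i<length c. Polynomial.monom (c ! i) i)"
  by (rule poly_eqI) (auto simp: coeff_sum nth_default_def)

lemma tau_inner:
  assumes "length c = n" "length d = n"
  shows "tau (Poly c * star (Poly d)) = (\<Sum>i<n. c ! i * (d ! i) ^ q)"
proof -
  have "Poly c * star (Poly d) =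
    (\<Sum>i<n. \<Sum>j<n. Polynomial.monom (c ! i) i * Polynomial.monom ((d ! j) ^ q) ((n - 1) * j))"
    by (simp add: Poly_eq_sum assms star_sum star_monom sum_product)
  also have "tau \<dots> = (\<Sum>i<n. \<Sum>j<n. if i = j then c ! i * (d ! i) ^ q else 0)"
    unfolding tau_sum
    by (intro sum.cong refl) (auto simp: mult_monom tau_monom dvd_index_iff add.commute[of _ "(n - 1) * _"] simp del: One_nat_def)
  finally show ?thesis by simp
qed

subsection \<open>Self-duality as a condition on ideals\<close>

text \<open>The Hermitian product of the word (v, t) with the extension of w. The last entry t is
  free because a vector of the dual is not known in advance to be an extended word.\<close>

definition form :: "'a poly \<Rightarrow> 'a \<Rightarrow> 'a poly \<Rightarrow> 'a" where
  "form v t w = tau (v * star w) + t * (- \<gamma> * poly w 1) ^ q"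

lemma poly_1_cong: "M dvd f - g \<Longrightarrow> poly f 1 = poly g 1"
proof -
  assume "M dvd f - g"
  then obtain h where "f - g = M * h" by (elim dvdE)
  then have "poly (f - g) 1 = 0" by (simp add: M_eq)
  then show ?thesis by simp
qed

lemma form_cong:
  assumes "M dvd v - v'" "M dvd w - w'"
  shows "form v t w = form v' t w'"
proof -
  have "M dvd star w - star w'" using M_dvd_star[OF assms(2)] by (simp add: star_diff)
  then have "M dvd (v - v') * star w + v' * (star w - star w')" using assms(1) by simp
  then have "M dvd v * star w - v' * star w'" by (simp add: algebra_simps)
  then show ?thesis using tau_cong poly_1_cong[OF assms(2)] by (simp add: form_def)
qed

lemma obtain_word:
  obtains c where "length c = n" "Poly c = v mod M" "M dvd Poly c - v"
proof
  let ?c = "map (Polynomial.coeff (v mod M)) [0..<n]"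
  have deg: "degree (v mod M) < n"
    using degree_mod_less[OF M_nonzero, of v] degree_M n_pos by auto
  show "length ?c = n" by simp
  show *: "Poly ?c = v mod M"
    by (rule poly_eqI) (use deg in \<open>auto simp: nth_default_def coeff_eq_0\<close>)
  show "M dvd Poly ?c - v" unfolding * by (metis mod_eq_dvd_iff mod_mod_trivial)
qed

lemma inner_extended:
  assumes "length c = n" "length d = n"
  shows "(\<Sum>i<n + 1. (c @ [t]) ! i * ((d @ [- \<gamma> * sum_list d]) ! i) ^ q) = form (Poly c) t (Poly d)"
proof -
  have "(\<Sum>i<n. (c @ [t]) ! i * ((d @ [- \<gamma> * sum_list d]) ! i) ^ q) = tau (Poly c * star (Poly d))"
    unfolding tau_inner[OF assms] by (rule sum.cong) (use assms in \<open>auto simp: nth_append\<close>)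
  then show ?thesis using assms by (simp add: form_def nth_append poly_Poly_1)
qed

text \<open>Membership in I, the value at 1 and \<open>form\<close> depend only on residues modulo
  \<open>M\<close>, so words of length n may be replaced by polynomials of any degree.\<close>

lemma self_dual_iff:
  assumes I: "ideal I ring_of_type_algebra" "M \<in> I"
  shows "hermitian_self_dual q (n + 1) (extended_code \<gamma> {c. length c = n \<and> Poly c \<in> I}) \<longleftrightarrow>
    (\<forall>v t. (v \<in> I \<and> t = - \<gamma> * poly v 1) \<longleftrightarrow> (\<forall>w\<in>I. form v t w = 0))" (is "?L \<longleftrightarrow> ?R")
proof -
  let ?C = "{c. length c = n \<and> Poly c \<in> I}"
  have I_cong: "f \<in> I \<longleftrightarrow> g \<in> I" if "M dvd f - g" for f g
  proof -
    have *: "f \<in> I" if "M dvd f - g" "g \<in> I" for f g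
    proof -
      have "f - g \<in> I" using that(1) I by (auto simp: dvd_def ring_ideal_of_type_algebra_iff mult.commute)
      then have "(f - g) + g \<in> I" using that(2) I(1) unfolding ring_ideal_of_type_algebra_iff by blast
      then show ?thesis by simp
    qed
    show ?thesis using *[of f g] *[of g f] that by (metis dvd_minus_iff minus_diff_eq)
  qed
  have ext: "c @ [t] \<in> extended_code \<gamma> ?C \<longleftrightarrow> Poly c \<in> I \<and> t = - \<gamma> * poly (Poly c) 1"
    if "length c = n" for c t
    using that by (auto simp: extended_code_def poly_Poly_1)
  have dual: "c @ [t] \<in> hermitian_dual q (n + 1) (extended_code \<gamma> ?C) \<longleftrightarrow> (\<forall>w\<in>I. form (Poly c) t w = 0)"
    if "length c = n" for c t
  proof -
    have "c @ [t] \<in> hermitian_dual q (n + 1) (extended_code \<gamma> ?C) \<longleftrightarrow>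
      (\<forall>d. length d = n \<and> Poly d \<in> I \<longrightarrow> form (Poly c) t (Poly d) = 0)"
      using that inner_extended[OF that] unfolding hermitian_dual_def extended_code_def by auto
    also have "\<dots> \<longleftrightarrow> (\<forall>w\<in>I. form (Poly c) t w = 0)"
    proof safe
      fix w assume *: "\<forall>d. length d = n \<and> Poly d \<in> I \<longrightarrow> form (Poly c) t (Poly d) = 0" and w: "w \<in> I"
      obtain d where d: "length d = n" "M dvd Poly d - w" using obtain_word by blast
      have "form (Poly c) t w = form (Poly c) t (Poly d)"
        using form_cong[of "Poly c" "Poly c" "Poly d" w t] d by simp
      then show "form (Poly c) t w = 0" using * d w I_cong by simp
    qed auto
    finally show ?thesis .
  qed
  have "?L \<longleftrightarrow> (\<forall>c t. length c = n \<longrightarrow> (c @ [t] \<in> extended_code \<gamma> ?C \<longleftrightarrow>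
      c @ [t] \<in> hermitian_dual q (n + 1) (extended_code \<gamma> ?C)))"
  proof
    assume R: "\<forall>c t. length c = n \<longrightarrow> (c @ [t] \<in> extended_code \<gamma> ?C \<longleftrightarrow>
      c @ [t] \<in> hermitian_dual q (n + 1) (extended_code \<gamma> ?C))"
    have len: "length u = n + 1" if "u \<in> extended_code \<gamma> ?C \<or>
        u \<in> hermitian_dual q (n + 1) (extended_code \<gamma> ?C)" for u
      using that by (auto simp: extended_code_def hermitian_dual_def)
    have "u \<in> extended_code \<gamma> ?C \<longleftrightarrow> u \<in> hermitian_dual q (n + 1) (extended_code \<gamma> ?C)" for u
    proof (cases "length u = n + 1")
      case True
      then obtain c t where "u = c @ [t]" "length c = n" by (cases u rule: rev_cases) auto
      then show ?thesis using R by blast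
    qed (use len in blast)
    then show ?L unfolding hermitian_self_dual_def by blast
  qed (auto simp: hermitian_self_dual_def)
  also have "\<dots> \<longleftrightarrow> (\<forall>c t. length c = n \<longrightarrow>
      (Poly c \<in> I \<and> t = - \<gamma> * poly (Poly c) 1 \<longleftrightarrow> (\<forall>w\<in>I. form (Poly c) t w = 0)))"
    using ext dual by auto
  also have "\<dots> \<longleftrightarrow> ?R"
  proof
    assume *: "\<forall>c t. length c = n \<longrightarrow>
      (Poly c \<in> I \<and> t = - \<gamma> * poly (Poly c) 1 \<longleftrightarrow> (\<forall>w\<in>I. form (Poly c) t w = 0))"
    show ?R
    proof (intro allI)
      fix v t
      obtain c where c: "length c = n" "M dvd Poly c - v" using obtain_word by blast
      have "form v t w = form (Poly c) t w" for w
        using form_cong[of "Poly c" v w w t] c by simp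
      moreover have "poly (Poly c) 1 = poly v 1" using c(2) by (rule poly_1_cong)
      ultimately show "(v \<in> I \<and> t = - \<gamma> * poly v 1) \<longleftrightarrow> (\<forall>w\<in>I. form v t w = 0)"
        using * c(1) I_cong[OF c(2)] by metis
    qed
  qed blast
  finally show ?thesis .
qed

subsection \<open>Self-orthogonality and divisibility by \<open>\<Phi>\<close>\<close>

text \<open>Additivity of the q-th power gives (-\<gamma>)^q = -(\<gamma>^q) in every
  characteristic, so the two signs cancel.\<close>

lemma neg_gamma: "- \<gamma> * (- \<gamma>) ^ q * of_nat n = -1"
proof -
  have "(\<gamma> + - \<gamma>) ^ q = \<gamma> ^ q + (- \<gamma>) ^ q" by (rule frobenius_add_1) (rule refl)
  then have "(- \<gamma>) ^ q = - (\<gamma> ^ q)" using q_pos by (simp add: add_eq_0_iff power_0_left)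
  then have "- \<gamma> * (- \<gamma>) ^ q * of_nat n = \<gamma> ^ (q + 1) * of_nat n" by simp
  then show ?thesis using gamma by (simp add: add_eq_0_iff)
qed

text \<open>Separability, from x M' - n M = n: a repeated factor divides \<open>M\<close> and its
  derivative, hence the nonzero constant n.\<close>

lemma square_dvd_M:
  assumes "c * c dvd M"
  shows "is_unit c"
proof -
  obtain k where k: "M = c * (c * k)" using assms by (metis dvd_def mult.assoc)
  have "pderiv M = c * pderiv (c * k) + (c * k) * pderiv c"
    unfolding k by (simp only: pderiv_mult)
  then have "c dvd pderiv M" by (simp add: mult.assoc)
  moreover have "c dvd M" unfolding k by (rule dvd_triv_left)
  ultimately have "c dvd Polynomial.monom 1 1 * pderiv M - smult (of_nat n) M"
    by (intro dvd_diff dvd_mult dvd_smult)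
  also have "Polynomial.monom 1 1 * pderiv M - smult (of_nat n) M = [:of_nat n:]"
    using n_pos by (simp add: M_def pderiv_diff pderiv_monom mult_monom smult_diff_right smult_monom
        del: One_nat_def)
  also have "[:of_nat n:] dvd (1 :: 'a poly)"
    using of_nat_n_nonzero by (simp add: is_unit_pCons_iff)
  finally show ?thesis .
qed

lemma dvd_M_coprime:
  assumes "a * b dvd M"
  shows "coprime a b"
proof (rule coprimeI)
  fix c assume "c dvd a" "c dvd b"
  then have "c * c dvd M" using dvd_trans[OF mult_dvd_mono assms] by blast
  then show "is_unit c" by (rule square_dvd_M)
qed

lemma not_dvd_linear:
  assumes "p dvd Phi" "\<not> is_unit p"
  shows "\<not> p dvd [:-1, 1:]"
proof
  assume "p dvd [:-1, 1:]"
  then have "p * p dvd M" unfolding M_eq using assms(1) by (rule mult_dvd_mono)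
  then show False using square_dvd_M assms(2) by blast
qed

text \<open>As x - 1 divides h - h(1), the product \<open>Phi * h\<close> is h(1) times
  \<open>Phi\<close> modulo \<open>M\<close>, and \<open>tau Phi\<close> is 1.\<close>

lemma tau_Phi_mult: "tau (Phi * h) = poly h 1"
proof -
  have "[:-1, 1:] dvd h - [:poly h 1:]" by (simp add: poly_eq_0_iff_dvd[symmetric])
  then have "M dvd (h - [:poly h 1:]) * Phi" unfolding M_eq by (rule mult_dvd_mono) simp
  moreover have "(h - [:poly h 1:]) * Phi = Phi * h - smult (poly h 1) Phi"
    by (simp add: algebra_simps)
  ultimately have "tau (Phi * h) = poly h 1 * tau Phi"
    using tau_cong[of "Phi * h" "smult (poly h 1) Phi"] tau_smult by simp
  moreover have "tau Phi = (\<Sum>i<n. if i = 0 then 1 else 0)"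
    unfolding Phi_def tau_sum by (rule sum.cong) (auto simp: tau_monom dest: dvd_imp_le)
  ultimately show ?thesis using n_pos by simp
qed

text \<open>Turns inner products into values at 1, using that \<open>Phi\<close> has value n there.
  By \<open>neg_gamma\<close> the last coordinates of two extended words contribute exactly the
  opposite amount.\<close>

lemma tau_of_Phi_dvd:
  assumes "Phi dvd f"
  shows "of_nat n * tau f = poly f 1"
proof -
  obtain h where "f = Phi * h" using assms by (elim dvdE)
  then show ?thesis by (simp add: tau_Phi_mult poly_Phi_1)
qed

lemma poly_star_1: "poly (star w) 1 = poly w 1 ^ q"
proof (induction w)
  case 0
  then show ?case using q_pos by simp
next
  case (pCons a u)
  then show ?case by (simp add: star_pCons poly_monom frobenius_add_1)
qed

text \<open>Cyclic shifts of v stay in I and keep the value v(1). Orthogonality of all shifts to w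
  therefore makes all coefficients of \<open>v * star w\<close> modulo \<open>M\<close> equal, so
  the residue is a multiple of \<open>Phi\<close>.\<close>

lemma Phi_dvd_mult_star:
  assumes "ideal I ring_of_type_algebra"
    and orth: "\<And>v w. v \<in> I \<Longrightarrow> w \<in> I \<Longrightarrow> form v (- \<gamma> * poly v 1) w = 0"
    and "v \<in> I" "w \<in> I"
  shows "Phi dvd v * star w"
proof -
  \<comment> \<open>The common coefficient: it must cancel the product of the two last
    entries.\<close>
  define c where "c = - (- \<gamma> * (- \<gamma>) ^ q * (poly v 1 * poly w 1 ^ q))"
  have "M dvd v * star w - smult c Phi"
  proof (rule M_dvdI)
    fix k
    let ?x = "Polynomial.monom 1 ((n - 1) * k) :: 'a poly"
    have "?x * v \<in> I" using assms(1,3) by (simp add: ring_ideal_of_type_algebra_iff)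
    then have "form (?x * v) (- \<gamma> * poly (?x * v) 1) w = 0" using assms(4) by (rule orth)
    moreover have "poly (?x * v) 1 = poly v 1" by (simp add: poly_monom)
    moreover have "(- \<gamma> * poly v 1) * (- \<gamma> * poly w 1) ^ q = - c"
      unfolding c_def power_mult_distrib by (simp only: mult_ac minus_minus)
    ultimately have "tau (?x * (v * star w)) = c"
      by (simp only: form_def mult.assoc) simp
    moreover have "tau (?x * smult c Phi) = c"
      using tau_Phi_mult[of ?x] by (simp add: tau_smult poly_monom mult.commute)
    moreover have "?x * (v * star w) = ?x * (v * star w - smult c Phi) + ?x * smult c Phi"
      by (simp add: algebra_simps)
    ultimately show "tau (?x * (v * star w - smult c Phi)) = 0"
      using tau_add[of "?x * (v * star w - smult c Phi)" "?x * smult c Phi"] by simp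
  qed
  then have "Phi dvd v * star w - smult c Phi" using Phi_dvd_M dvd_trans by blast
  then show ?thesis using dvd_add[of Phi "v * star w - smult c Phi" "smult c Phi"] by (simp add: dvd_smult)
qed

lemma self_dual_imp_no_prime:
  assumes I: "ideal I ring_of_type_algebra"
    and dual: "\<And>v t. (v \<in> I \<and> t = - \<gamma> * poly v 1) \<longleftrightarrow> (\<forall>w\<in>I. form v t w = 0)"
    and r: "Factorial_Ring.prime r" "r dvd n" and j: "odd j" "r dvd q ^ j + 1"
  shows False
proof -
  let ?R = "Polynomial.monom 1 r - 1 :: 'a poly" and ?F = "\<Sum>i<r. Polynomial.monom 1 i :: 'a poly"
  have "r > 1" using r(1) by (rule prime_gt_1_nat)
  have R_eq: "?R = [:-1, 1:] * ?F" by (rule monom_minus_one_eq)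
  have "degree ?R = r" using \<open>r > 1\<close> by (intro degree_monom_minus_one) simp
  moreover have "?F \<noteq> 0" using R_eq calculation \<open>r > 1\<close> by (metis degree_0 less_numeral_extra(3) mult_zero_right not_one_less_zero)
  moreover have "degree ([:-1, 1:] * ?F) = degree [:-1, 1 :: 'a:] + degree ?F"
    using \<open>?F \<noteq> 0\<close> by (intro degree_mult_eq) simp_all
  ultimately have "degree ?F = r - 1" unfolding R_eq by simp
  then have "\<not> is_unit ?F" using \<open>r > 1\<close> \<open>?F \<noteq> 0\<close> by (simp add: is_unit_iff_degree)
  then obtain p where p: "Factorial_Ring.irreducible p" "p dvd ?F"
    using irreducible_divisor_field_poly \<open>?F \<noteq> 0\<close> by blast
  have pr: "prime_elem p" using p(1) by (rule field_poly_irreducible_imp_prime)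
  have "?R dvd M" unfolding M_def
    using monom_dvd_monom_diff[of n 0 r] r(2) by (simp add: cong_0_iff)
  then have "?F dvd Phi" unfolding R_eq M_eq by (simp only: dvd_mult_cancel_left) simp
  then have "p dvd Phi" using p(2) dvd_trans by blast
  have "p dvd ?R" unfolding R_eq using p(2) by (rule dvd_mult)
  \<comment> \<open>Modulo p, conjugation is a power map, so p divides \<open>star w\<close>
    whenever it divides w.\<close>
  have star: "p dvd star w - w ^ (q ^ j)" for w
    using star_cong_power[OF j r(2), of w] \<open>p dvd ?R\<close> dvd_trans by blast
  have orth: "form v (- \<gamma> * poly v 1) w = 0" if "v \<in> I" "w \<in> I" for v w
    using dual that by blast
  have pI: "p dvd w" if "w \<in> I" for w
  proof -
    have "p dvd w * star w" using Phi_dvd_mult_star[OF I orth that that] \<open>p dvd Phi\<close> dvd_trans by blast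
    then have "p dvd w * star w - w * (star w - w ^ (q ^ j))" using star by simp
    then have "p dvd w ^ Suc (q ^ j)" by (simp add: algebra_simps)
    then show ?thesis using pr prime_elem_dvd_power by blast
  qed
  \<comment> \<open>The cofactor v of p is orthogonal to I already with last entry 0. Duality puts v
    into I, so p divides v and \<open>M\<close> has a square factor.\<close>
  obtain v where v: "M = p * v" using \<open>p dvd Phi\<close> Phi_dvd_M by (metis dvd_trans dvd_def)
  have "form v 0 w = 0" if "w \<in> I" for w
  proof -
    have "p dvd w ^ (q ^ j)"
      using dvd_trans[OF pI[OF that] dvd_power[of "q ^ j" w]] q_pos by simp
    from dvd_add[OF star[of w] this] have "p dvd star w" by simp
    then have "M dvd v * star w - 0" unfolding v by (simp add: mult_dvd_mono mult.commute[of p])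
    then show ?thesis using tau_cong[of "v * star w" 0] by (simp add: form_def)
  qed
  then have "v \<in> I" using dual[of v 0] by blast
  then have "p * p dvd M" unfolding v using pI by (simp add: mult_dvd_mono)
  then show False using square_dvd_M[of p] p(1) by (simp add: irreducible_not_unit)
qed

text \<open>Products of multiples of g are divisible by \<open>Phi\<close>, which gives
  self-orthogonality through \<open>tau_of_Phi_dvd\<close>. Conversely, testing against multiples of
  (x - 1) g forces g to divide v, and testing against \<open>Phi\<close> determines t.\<close>

lemma generator_self_dual:
  assumes g: "g dvd Phi" "Phi dvd g * star g" "coprime g (star g)"
  shows "(v \<in> {f. g dvd f} \<and> t = - \<gamma> * poly v 1) \<longleftrightarrow> (\<forall>w\<in>{f. g dvd f}. form v t w = 0)"
proof
  have Phi_dvd: "Phi dvd v * star w" if "g dvd v" "g dvd w" for v w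
    using mult_dvd_mono[OF that(1) dvd_star[OF that(2)]] g(2) dvd_trans by blast
  {
    assume v: "v \<in> {f. g dvd f} \<and> t = - \<gamma> * poly v 1"
    show "\<forall>w\<in>{f. g dvd f}. form v t w = 0"
    proof
      fix w assume "w \<in> {f. g dvd f}"
      then have "of_nat n * tau (v * star w) = poly v 1 * poly w 1 ^ q"
        using tau_of_Phi_dvd Phi_dvd v by (simp add: poly_star_1)
      moreover have "of_nat n * (t * (- \<gamma> * poly w 1) ^ q)
          = (- \<gamma> * (- \<gamma>) ^ q * of_nat n) * (poly v 1 * poly w 1 ^ q)"
        unfolding conjunct2[OF v] power_mult_distrib by (simp only: mult_ac)
      ultimately have "of_nat n * form v t w = 0"
        by (simp only: form_def distrib_left neg_gamma) simp
      then show "form v t w = 0" using of_nat_n_nonzero by simp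
    qed
  }
  {
    assume orth: "\<forall>w\<in>{f. g dvd f}. form v t w = 0"
    have lin: "star [:-1, 1:] = Polynomial.monom 1 (n - 1) - 1"
    proof -
      have "star (Polynomial.monom 1 1 - 1) = Polynomial.monom 1 (n - 1) - 1"
        by (simp add: star_diff star_monom)
      moreover have "Polynomial.monom 1 1 - 1 = ([:-1, 1:] :: 'a poly)"
        by (simp add: monom_altdef one_pCons)
      ultimately show ?thesis by simp
    qed
    have "g \<noteq> 0" using g(1) M_nonzero M_eq by auto
    have "M dvd v * star ([:-1, 1:] * g)"
    proof (rule M_dvdI)
      fix k
      \<comment> \<open>The factor x - 1 makes the test word vanish at 1, which removes t from
        \<open>form\<close>.\<close>
      let ?w = "[:-1, 1:] * g * Polynomial.monom 1 k"
      have "form v t ?w = 0" using orth by (simp del: mult_pCons_left)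
      then show "tau (Polynomial.monom 1 ((n - 1) * k) * (v * star ([:-1, 1:] * g))) = 0"
        using q_pos by (simp add: form_def star_mult star_monom power_0_left mult_ac del: mult_pCons_left)
    qed
    then have "M dvd (star [:-1, 1:] * star g) * v"
      by (simp only: star_mult mult_ac)
    then have "g dvd (star [:-1, 1:] * star g) * v"
      by (rule dvd_trans[OF dvd_trans[OF g(1) Phi_dvd_M]])
    moreover have "coprime g (star [:-1, 1:] * star g)"
    proof (rule coprime_field_polyI[OF \<open>g \<noteq> 0\<close>])
      fix s assume s: "Factorial_Ring.irreducible s" "s dvd g" "s dvd star [:-1, 1:] * star g"
      then have "s dvd star [:-1, 1:] \<or> s dvd star g"
        using prime_elem_dvd_mult_iff[OF field_poly_irreducible_imp_prime[OF s(1)]] by blast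
      moreover have nu: "\<not> is_unit s" using s(1) by (simp add: irreducible_not_unit)
      then have "\<not> s dvd star g" using coprime_common_divisor[OF g(3) s(2)] by blast
      ultimately have "s dvd Polynomial.monom 1 (n - 1) - 1" unfolding lin by blast
      moreover have "s dvd Phi" using s(2) g(1) dvd_trans by blast
      \<comment> \<open>From x^n - 1 - x (x^(n-1) - 1) = x - 1.\<close>
      ultimately have "s dvd M - Polynomial.monom 1 1 * (Polynomial.monom 1 (n - 1) - 1)"
        by (intro dvd_diff[OF dvd_trans[OF _ Phi_dvd_M] dvd_mult])
      also have "\<dots> = [:-1, 1:]"
        using n_pos by (simp add: M_def right_diff_distrib mult_monom del: One_nat_def)
         (simp add: monom_altdef one_pCons)
      finally show False using not_dvd_linear[OF \<open>s dvd Phi\<close> nu] by blast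
    qed
    ultimately have gv: "g dvd v" using coprime_dvd_mult_field_poly by blast
    \<comment> \<open>N is the value of \<open>star Phi\<close> at 1.\<close>
    define N where "N = (of_nat n :: 'a) ^ q"
    have "N \<noteq> 0" using of_nat_n_nonzero by (simp add: N_def)
    have "form v t Phi = 0" using orth g(1) by simp
    then have "tau (v * star Phi) + t * (- \<gamma>) ^ q * N = 0"
      by (simp only: form_def poly_Phi_1 power_mult_distrib N_def mult.assoc)
    then have "of_nat n * tau (v * star Phi) + of_nat n * (t * (- \<gamma>) ^ q * N) = 0"
      by (simp only: distrib_left[symmetric] mult_zero_right)
    moreover have "of_nat n * tau (v * star Phi) = poly v 1 * N"
      using tau_of_Phi_dvd[OF Phi_dvd[OF gv g(1)]] by (simp add: poly_star_1 poly_Phi_1 N_def)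
    ultimately have "(poly v 1 + of_nat n * (t * (- \<gamma>) ^ q)) * N = 0"
      by (simp add: algebra_simps)
    then have "- \<gamma> * (poly v 1 + of_nat n * (t * (- \<gamma>) ^ q)) = 0" using \<open>N \<noteq> 0\<close> by simp
    then have "- \<gamma> * poly v 1 + (- \<gamma> * (- \<gamma>) ^ q * of_nat n) * t = 0"
      by (simp only: distrib_left mult_ac)
    then have "t = - \<gamma> * poly v 1" unfolding neg_gamma by (simp add: add_eq_0_iff)
    with gv show "v \<in> {f. g dvd f} \<and> t = - \<gamma> * poly v 1" by simp
  }
qed

subsection \<open>Existence of a self-dual code\<close>

text \<open>If an irreducible p divided both g and \<open>star g\<close>, then k = g / p would still
  satisfy the requirement: with \<open>Phi\<close> = k p l, both p and l divide
  \<open>star k\<close> and are coprime. This contradicts the least degree of g.\<close>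

lemma exists_generator:
  assumes H: "\<And>p. Factorial_Ring.irreducible p \<Longrightarrow> p dvd Phi \<Longrightarrow> \<not> p dvd star p"
  obtains g where "g dvd Phi" "Phi dvd g * star g" "coprime g (star g)"
proof -
  let ?P = "\<lambda>g. g dvd Phi \<and> Phi dvd g * star g"
  define g where "g = arg_min degree ?P"
  have g: "?P g" unfolding g_def by (rule arg_min_natI[of _ Phi]) simp
  have min: "degree g \<le> degree h" if "?P h" for h
    unfolding g_def by (rule arg_min_nat_le) (rule that)
  have Phi_nonzero: "Phi \<noteq> 0" using M_nonzero M_eq by auto
  have "g \<noteq> 0" using g Phi_nonzero by auto
  have "coprime g (star g)"
  proof (rule coprime_field_polyI[OF \<open>g \<noteq> 0\<close>])
    fix p assume p: "Factorial_Ring.irreducible p" "p dvd g" "p dvd star g"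
    have nu: "\<not> is_unit p" using p(1) by (simp add: irreducible_not_unit)
    have pr: "prime_elem p" using p(1) by (rule field_poly_irreducible_imp_prime)
    have "p dvd Phi" using p(2) g dvd_trans by blast
    obtain k where k: "g = p * k" using p(2) by (elim dvdE)
    obtain l where l: "Phi = g * l" using g by (elim conjE dvdE)
    have M_pkl: "M = p * (k * ([:-1, 1:] * l))" by (simp only: M_eq l k mult_ac)
    have "p dvd star k"
      using p(3) H[OF p(1) \<open>p dvd Phi\<close>] pr by (simp add: k star_mult prime_elem_dvd_mult_iff)
    have "p * (k * l) dvd p * (k * (star p * star k))"
      using g unfolding l k star_mult by (simp only: mult_ac)
    then have "l dvd star p * star k" using k \<open>g \<noteq> 0\<close> by simp
    moreover have "coprime l (star p)"
    proof (rule coprime_field_polyI)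
      show "l \<noteq> 0" using l Phi_nonzero by auto
      fix s assume s: "Factorial_Ring.irreducible s" "s dvd l" "s dvd star p"
      have "s dvd M" using s(2) by (simp only: M_eq l dvd_mult)
      \<comment> \<open>Conjugating twice brings s back to a divisor of k, so s divides both k and
        l, against separability.\<close>
      have "star p dvd star (star k)" using \<open>p dvd star k\<close> by (rule dvd_star)
      then have "s dvd star (star k) - (star (star k) - k)"
        by (intro dvd_diff dvd_trans[OF s(3)] dvd_trans[OF \<open>s dvd M\<close> M_dvd_star_star])
      then have "s dvd k" by simp
      then have "s * s dvd k * l" using s(2) by (rule mult_dvd_mono)
      also have "k * l dvd M" unfolding M_pkl by (intro dvd_mult mult_dvd_mono) simp_all
      finally show False using square_dvd_M[of s] s(1) by (simp add: irreducible_not_unit)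
    qed
    ultimately have "l dvd star k" by (rule coprime_dvd_mult_field_poly[rotated])
    moreover have "coprime p l"
    proof (rule dvd_M_coprime)
      show "p * l dvd M" unfolding M_pkl by (intro mult_dvd_mono dvd_mult) simp_all
    qed
    ultimately have "p * l dvd star k" using \<open>p dvd star k\<close> coprime_mult_dvd_field_poly by blast
    then have "k * (p * l) dvd k * star k" by (rule mult_dvd_mono[OF dvd_refl])
    then have "Phi dvd k * star k" unfolding l k by (simp only: mult_ac)
    moreover have "k dvd Phi" unfolding l k by simp
    ultimately have "degree g \<le> degree k" by (intro min) simp
    moreover have "degree p > 0" using nu p(1)
      using is_unit_iff_degree[of p] by (auto simp: Factorial_Ring.irreducible_def)
    ultimately show False using \<open>g \<noteq> 0\<close> k by (simp add: degree_mult_eq)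
  qed
  with g that show ?thesis by blast
qed

section \<open>Roots in the algebraic closure and their Frobenius orbits\<close>

lemma power_q_poly:
  fixes f :: "'a alg_closure poly"
  shows "poly f x ^ q = poly (map_poly (\<lambda>a. a ^ q) f) (x ^ q)"
proof (induction f)
  case 0
  then show ?case using q_pos by (simp add: power_0_left)
next
  case (pCons a f)
  have "(a + x * poly f x) ^ q = a ^ q + x ^ q * poly f x ^ q"
    by (simp add: frobenius_add_1 power_mult_distrib)
  then show ?case using pCons q_pos by (simp add: map_poly_pCons power_0_left)
qed

lemma to_ac_poly_star:
  "poly (map_poly to_ac (star u)) x = poly (map_poly (\<lambda>a. to_ac a ^ q) u) (x ^ (n - 1))"
proof (induction u)
  case (pCons a u)
  have "poly (map_poly to_ac (star (pCons a u))) x = to_ac a ^ q + x ^ (n - 1) * poly (map_poly to_ac (star u)) x"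
    by (simp add: star_pCons map_poly_hom_add map_poly_hom_mult map_poly_monom map_poly_pCons poly_monom)
  then show ?case using pCons q_pos by (simp add: map_poly_pCons power_0_left)
qed simp

text \<open>The polynomial x^(q^2) - x has at most q^2 roots, and the embedded field already
  supplies that many.\<close>

lemma fixed_imp_range_to_ac:
  fixes c :: "'a alg_closure"
  assumes "c ^ (q\<^sup>2) = c"
  shows "c \<in> range to_ac"
proof (rule ccontr)
  assume c: "c \<notin> range to_ac"
  let ?f = "Polynomial.monom 1 (q\<^sup>2) - Polynomial.monom 1 1 :: 'a alg_closure poly"
  have "CARD('a) > 1"
    using card_mono[of "UNIV :: 'a set" "{0, 1}"] by simp
  then have Q: "q\<^sup>2 > 1" by (simp add: card_field)
  have deg: "degree ?f \<le> q\<^sup>2"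
    using Q by (intro degree_diff_le order_trans[OF degree_monom_le]) simp_all
  have "Polynomial.coeff ?f (q\<^sup>2) = 1" using Q by simp
  then have "?f \<noteq> 0" by (metis coeff_0 zero_neq_one)
  have "insert c (range to_ac) \<subseteq> {x. poly ?f x = 0}"
    using assms power_card_eq_self[where 'a = 'a]
    by (auto simp: poly_monom card_field to_ac_power[symmetric] simp del: to_ac_power)
  then have "card (insert c (range to_ac)) \<le> degree ?f"
    using card_mono[OF poly_roots_finite[OF \<open>?f \<noteq> 0\<close>]] card_poly_roots_bound[OF \<open>?f \<noteq> 0\<close>]
      order_trans by blast
  moreover have "card (range (to_ac :: 'a \<Rightarrow> _)) = q\<^sup>2"
    unfolding card_image[OF inj_to_ac] by (rule card_field)
  ultimately show False using c deg by simp
qed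

text \<open>
  Raising coefficients to the power \<open>q\<^sup>2\<close> permutes the factors cyclically, so it fixes the
  coefficients of the product.
\<close>
lemma frobenius_orbit_poly:
  fixes \<alpha> :: "'a alg_closure"
  assumes "\<alpha> ^ ((q\<^sup>2) ^ e) = \<alpha>"
  obtains P where "map_poly to_ac P = (\<Prod>i<e. [:- (\<alpha> ^ ((q\<^sup>2) ^ i)), 1:])"
proof -
  let ?F = "map_poly (\<lambda>x. x ^ (q\<^sup>2)) :: 'a alg_closure poly \<Rightarrow> _"
  let ?l = "\<lambda>i. [:- (\<alpha> ^ ((q\<^sup>2) ^ i)), 1:]"
  define P where "P = (\<Prod>i<e. ?l i)"
  have add: "(x + y) ^ (q\<^sup>2) = x ^ (q\<^sup>2) + y ^ (q\<^sup>2)" for x y :: "'a alg_closure"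
    using frobenius_add[of x y 2] by simp
  have zero: "(0 :: 'a alg_closure) ^ (q\<^sup>2) = 0" using q_pos by (simp add: power_0_left)
  have neg: "(- x) ^ (q\<^sup>2) = - (x ^ (q\<^sup>2))" for x :: "'a alg_closure"
    using add[of x "- x"] zero by (simp add: add_eq_0_iff)
  have F_mult: "?F (f * g) = ?F f * ?F g" for f g
    by (rule map_poly_hom_mult) (auto simp: add zero power_mult_distrib)
  have F_prod: "?F (prod h A) = (\<Prod>i\<in>A. ?F (h i))" for h :: "nat \<Rightarrow> _" and A
    by (induction A rule: infinite_finite_induct) (auto simp: F_mult)
  have F_l: "?F (?l i) = ?l (Suc i)" for i
    by (simp add: map_poly_pCons zero neg mult.commute flip: power_mult)
  have "?l 0 * (\<Prod>i<e. ?l (Suc i)) = (\<Prod>i<Suc e. ?l i)"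
    by (simp only: prod.lessThan_Suc_shift)
  also have "\<dots> = ?l 0 * P" using assms by (simp add: P_def mult.commute)
  finally have "(\<Prod>i<e. ?l (Suc i)) = P" by (subst (asm) mult_cancel_left) auto
  then have "?F P = P" by (simp only: P_def F_prod F_l)
  then have "Polynomial.coeff P i ^ (q\<^sup>2) = Polynomial.coeff P i" for i
    using coeff_map_poly[of "\<lambda>x. x ^ (q\<^sup>2)" P i] zero by simp
  then have "to_ac (of_ac (Polynomial.coeff P i)) = Polynomial.coeff P i" for i
    by (intro to_ac_of_ac fixed_imp_range_to_ac)
  then have "map_poly to_ac (map_poly of_ac P) = P"
    by (intro poly_eqI) (simp add: coeff_map_poly)
  with that show ?thesis unfolding P_def by blast
qed

text \<open>A root \<alpha> of p is an n-th root of unity other than 1. Since p divides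
  \<open>star p\<close>, the element \<alpha>^(-q) lies in the orbit of \<alpha> under the power
  q^2. This gives \<alpha>^(q (q^j + 1)) = 1 with j odd, so this exponent shares a prime with
  n.\<close>

lemma irreducible_dvd_star_imp_prime:
  assumes p: "Factorial_Ring.irreducible p" "p dvd Phi" "p dvd star p"
  obtains r j where "Factorial_Ring.prime r" "r dvd n" "odd j" "r dvd q ^ j + 1"
proof -
  define ev :: "'a alg_closure \<Rightarrow> 'a poly \<Rightarrow> 'a alg_closure" where "ev x f = poly (map_poly to_ac f) x" for x f
  have ev_mult: "ev x (f * g) = ev x f * ev x g" for x f g
    by (simp add: ev_def map_poly_hom_mult)
  have ev_add: "ev x (f + g) = ev x f + ev x g" for x f g
    by (simp add: ev_def map_poly_hom_add)
  have ev_1: "ev x 1 = 1" for x by (simp add: ev_def)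
  have ev_dvd: "ev x g = 0" if "f dvd g" "ev x f = 0" for x f g
    using that by (auto simp: dvd_def ev_mult)
  have "degree p > 0"
    using p(1) is_unit_iff_degree[of p] by (auto simp: Factorial_Ring.irreducible_def)
  then have "degree (map_poly to_ac p) > 0" by (subst degree_map_poly) auto
  then obtain \<alpha> where \<alpha>: "ev \<alpha> p = 0"
    using alg_closed_imp_poly_has_root[of "map_poly to_ac p"] unfolding ev_def by blast
  have "ev \<alpha> Phi = 0" using ev_dvd p(2) \<alpha> by blast
  then have "ev \<alpha> (M + 1) = 1" by (simp only: M_eq ev_add ev_mult ev_1) simp
  then have \<alpha>n: "\<alpha> ^ n = 1" by (simp add: M_def ev_def map_poly_monom poly_monom)
  have "\<alpha> \<noteq> 1"
  proof
    assume "\<alpha> = 1"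
    have "ev 1 f = to_ac (poly f 1)" for f
      by (induction f) (simp_all add: ev_def map_poly_pCons)
    then have "to_ac (of_nat n :: 'a) = 0" using \<open>ev \<alpha> Phi = 0\<close> \<open>\<alpha> = 1\<close> poly_Phi_1 by simp
    then show False using of_nat_n_nonzero by (simp del: to_ac_of_nat)
  qed
  have \<alpha>_cong: "\<alpha> ^ i = \<alpha> ^ k" if "[i = k] (mod n)" for i k
  proof -
    have "\<alpha> ^ (n * (i div n) + i mod n) = \<alpha> ^ (i mod n)" for i
      unfolding power_add power_mult \<alpha>n by simp
    then have "\<alpha> ^ i = \<alpha> ^ (i mod n)" for i by (simp only: mult_div_mod_eq)
    from this[of i] this[of k] that show ?thesis by (simp only: cong_def)
  qed
  \<comment> \<open>By Euler's theorem e steps of the power q^2 return to \<alpha>. The orbit may be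
    repeated, which is harmless for the product.\<close>
  define e where "e = totient n"
  have "e > 0" using n_pos by (simp add: e_def)
  have "[q ^ e = 1] (mod n)" unfolding e_def
    using coprime_n_q by (intro euler_theorem) (simp add: coprime_commute)
  then have "[(q ^ e)\<^sup>2 = 1\<^sup>2] (mod n)" by (rule cong_pow)
  then have Qe: "[(q\<^sup>2) ^ e = 1] (mod n)" by (simp add: power_mult[symmetric] mult.commute)
  then have \<alpha>e: "\<alpha> ^ ((q\<^sup>2) ^ e) = \<alpha>" using \<alpha>_cong[OF Qe] by simp
  obtain P where P: "map_poly to_ac P = (\<Prod>i<e. [:- (\<alpha> ^ ((q\<^sup>2) ^ i)), 1:])"
    by (rule frobenius_orbit_poly[OF \<alpha>e])
  have ev_P: "ev x P = (\<Prod>i<e. x - \<alpha> ^ ((q\<^sup>2) ^ i))" for x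
    by (simp add: ev_def P poly_prod)
  have "ev \<alpha> P = 0" unfolding ev_P using \<open>e > 0\<close> by (intro prod_zero) (auto intro!: bexI[of _ 0])
  \<comment> \<open>The irreducible p shares the root \<alpha> with P, so a Bezout identity rules
    out coprimality.\<close>
  have "p dvd P"
  proof (rule ccontr)
    assume "\<not> p dvd P"
    then have "coprime p P" using p(1) by (rule irreducible_coprime_field_poly[rotated])
    then obtain x y where "x * p + y * P = 1" by (rule coprime_field_poly_bezout)
    then have "ev \<alpha> (x * p + y * P) = 1" by (simp add: ev_1)
    then show False using \<alpha> \<open>ev \<alpha> P = 0\<close> by (simp add: ev_add ev_mult)
  qed
  then have "p dvd star P" using p(3) dvd_star dvd_trans by blast
  then have "ev \<alpha> (star P) = 0" using \<alpha> ev_dvd by blast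
  define \<beta> where "\<beta> = \<alpha> ^ (n - 1)"
  \<comment> \<open>The outer q-th power conjugates the coefficients of P a second time and so
    restores them, leaving P evaluated at \<beta>^q.\<close>
  have "ev \<alpha> (star P) ^ q = poly (map_poly (\<lambda>a. a ^ q) (map_poly (\<lambda>a. to_ac a ^ q) P)) (\<beta> ^ q)"
    unfolding ev_def to_ac_poly_star power_q_poly \<beta>_def ..
  also have "map_poly (\<lambda>a. a ^ q) (map_poly (\<lambda>a. to_ac a ^ q) P) = map_poly to_ac P"
    using q_pos by (intro poly_eqI)
      (simp add: coeff_map_poly power_0_left to_ac_power[symmetric] power_q_q del: to_ac_power)
  finally have "ev (\<beta> ^ q) P = 0" using \<open>ev \<alpha> (star P) = 0\<close> q_pos by (simp add: ev_def power_0_left)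
  then obtain i where i: "\<beta> ^ q = \<alpha> ^ ((q\<^sup>2) ^ i)" unfolding ev_P by auto
  \<comment> \<open>Adding the period e leaves the orbit element unchanged and keeps the subtraction
    exact when i = 0.\<close>
  define j where "j = 2 * (i + e) - 1"
  have "odd j" "Suc j = 2 * (i + e)" using \<open>e > 0\<close> by (auto simp: j_def)
  have "\<alpha> ^ ((q\<^sup>2) ^ (i + e)) = \<alpha> ^ ((q\<^sup>2) ^ i)"
    using \<alpha>_cong[OF cong_mult[OF cong_refl[of "(q\<^sup>2) ^ i"] Qe]] by (simp add: power_add)
  then have "\<alpha> ^ (q ^ Suc j) = \<beta> ^ q"
    unfolding \<open>Suc j = 2 * (i + e)\<close> i power_mult[of q 2] .
  moreover have "\<beta> * \<alpha> = 1"
    using power_minus_mult[OF n_pos, of \<alpha>] \<alpha>n by (simp add: \<beta>_def)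
  then have "\<beta> ^ q * \<alpha> ^ q = 1" by (simp flip: power_mult_distrib)
  ultimately have "\<alpha> ^ (q ^ Suc j + q) = 1" by (simp only: power_add)
  then have \<alpha>1: "\<alpha> ^ (q * (q ^ j + 1)) = 1" by (simp add: algebra_simps)
  \<comment> \<open>An inverse of the exponent modulo n would give \<alpha> = 1.\<close>
  have "\<not> coprime (q * (q ^ j + 1)) n"
  proof
    assume "coprime (q * (q ^ j + 1)) n"
    then obtain x where "[q * (q ^ j + 1) * x = 1] (mod n)" using cong_solve_coprime_nat by auto
    then have "\<alpha> ^ (q * (q ^ j + 1) * x) = \<alpha> ^ 1" by (rule \<alpha>_cong)
    then show False using \<alpha>1 \<open>\<alpha> \<noteq> 1\<close> unfolding power_mult[of \<alpha> _ x] by simp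
  qed
  then obtain d where d: "d dvd q * (q ^ j + 1)" "d dvd n" "d \<noteq> 1"
    by (auto elim: not_coprimeE)
  obtain r where "Factorial_Ring.prime r" "r dvd d" using prime_factor_nat[OF d(3)] by blast
  with d have r: "Factorial_Ring.prime r" "r dvd q * (q ^ j + 1)" "r dvd n"
    by (auto intro: dvd_trans)
  have "\<not> r dvd q" using r(1,3) coprime_n_q coprime_common_divisor[of n q r] by auto
  then have "r dvd q ^ j + 1" using r(1,2) prime_dvd_mult_iff by blast
  with that r \<open>odd j\<close> show ?thesis by blast
qed

lemma exists_self_dual_iff:
  "(\<exists>C. cyclic_code n C \<and> hermitian_self_dual q (n + 1) (extended_code \<gamma> C)) \<longleftrightarrow>
   \<not> (\<exists>r. Factorial_Ring.prime r \<and> r dvd n \<and> (\<exists>j. odd j \<and> r dvd q ^ j + 1))"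
  (is "?L \<longleftrightarrow> \<not> ?R")
proof
  assume ?L
  then obtain C where C: "cyclic_code n C" "hermitian_self_dual q (n + 1) (extended_code \<gamma> C)"
    by blast
  obtain I where I: "ideal I ring_of_type_algebra" "M \<in> I" "C = {c. length c = n \<and> Poly c \<in> I}"
    using C(1) unfolding cyclic_code_iff M_def[symmetric] by blast
  have dual: "(v \<in> I \<and> t = - \<gamma> * poly v 1) \<longleftrightarrow> (\<forall>w\<in>I. form v t w = 0)" for v t
    using C(2) unfolding I(3) self_dual_iff[OF I(1,2)] by simp
  show "\<not> ?R"
    using self_dual_imp_no_prime[OF I(1) dual] by metis
next
  assume R: "\<not> ?R"
  have "\<not> p dvd star p" if "Factorial_Ring.irreducible p" "p dvd Phi" for p
  proof
    assume "p dvd star p"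
    with that obtain r j where "Factorial_Ring.prime r" "r dvd n" "odd j" "r dvd q ^ j + 1"
      by (rule irreducible_dvd_star_imp_prime)
    then show False using R by blast
  qed
  then obtain g where g: "g dvd Phi" "Phi dvd g * star g" "coprime g (star g)"
    by (rule exists_generator)
  let ?I = "{f. g dvd f}"
  have I: "ideal ?I ring_of_type_algebra" "M \<in> ?I"
    using g(1) Phi_dvd_M by (auto simp: ring_ideal_of_type_algebra_iff intro: dvd_trans)
  let ?C = "{c. length c = n \<and> Poly c \<in> ?I}"
  have "cyclic_code n ?C"
    unfolding cyclic_code_iff M_def[symmetric] using I by (intro exI[of _ ?I]) simp
  moreover have "hermitian_self_dual q (n + 1) (extended_code \<gamma> ?C)"
    unfolding self_dual_iff[OF I] by (intro allI generator_self_dual[OF g])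
  ultimately show ?L by blast
qed

end

theorem theorem5p8:
  fixes q n :: nat and \<gamma> :: "'a::{field,finite}"
  assumes "primepow q"
    and "CARD('a) = q ^ 2"
    and "odd n" and "n > 0"
    and "coprime n q"
    and "1 + \<gamma> ^ (q + 1) * of_nat n = 0"
  shows "(\<exists>C :: 'a list set. cyclic_code n C \<and>
            hermitian_self_dual q (n + 1) (extended_code \<gamma> C)) \<longleftrightarrow>
         (\<forall>r. Factorial_Ring.prime r \<and> r dvd n \<longrightarrow> odd (ord r q) \<or> even (ord r (q ^ 2)))"
proof -
  interpret hermitian_setting q n \<gamma>
    by unfold_locales (fact assms)+
  \<comment> \<open>Prime divisors of the odd number n are odd, as
    \<open>odd_power_dvd_iff_ord\<close> requires.\<close>
  have "(\<exists>j. odd j \<and> r dvd q ^ j + 1) \<longleftrightarrow> even (ord r q) \<and> odd (ord r (q\<^sup>2))"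
    if "Factorial_Ring.prime r" "r dvd n" for r
    using that assms(3) by (intro odd_power_dvd_iff_ord) (auto dest: dvd_trans)
  then show ?thesis unfolding exists_self_dual_iff by blast
qed

end
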